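(* Let $\omega$, $\mathcal{A}$, the polynomials $f_i$, their degree-$2\omega$ homogenizations $\bar f_i$, the matrices $Q^i$ ($i=0,\dots,m$) and $H^0$, the cone $\mathbb{J}$ and the set $\widetilde S_m$ be as defined in the context, and let $$\zeta^*=\inf\{f_0(w): w\in\mathbb{R}^n_+,\ f_i(w)=0\ (i=1,\dots,m)\}.$$ Assume that this optimization problem is feasible, and that $\mathbb{J}$ is a face of $\mathbb{CPP}^{\mathcal{A}}$. Then $$\zeta^*=\inf\{\langle Q^0,X\rangle: X\in\mathbb{J},\ \langle H^0,X\rangle=1\}$$ if and only if $$\inf\{\bar f_0(0,w): w\in\widetilde S_m\}\ge 0\quad\text{or}\quad \zeta^*=-\infty .$$
   Context: Let $f_0,\dots,f_m$ be real polynomials in $w=(w_1,\dots,w_n)\in\mathbb{R}^n$, and let $\omega$ be a positive integer with $2\omega\ge\max_i\deg f_i$. Points of $\mathbb{R}^{1+n}$ are written $x=(x_0,w)$ with $x_0\in\mathbb{R}$, $w\in\mathbb{R}^n$. For each $i$, $\bar f_i$ is the homogeneous polynomial of degree $2\omega$ in $x=(x_0,w)$ with $\bar f_i(1,w)=f_i(w)$ for all $w$ (each monomial of degree $\tau_0$ in $f_i$ is multiplied by $x_0^{2\omega-\tau_0}$). Let $\mathcal{A}_\omega=\{\alpha\in\mathbb{Z}^{1+n}_+:\sum_j\alpha_j=\omega\}$. Let $\mathcal{A}\subset\mathcal{A}_\omega$ be chosen to contain $\alpha^\omega=(\omega,0,\dots,0)$ and such that every monomial occurring in some $\bar f_i$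 is of the form $x^{\alpha+\beta}$ with $\alpha,\beta\in\mathcal{A}$. $\mathbb{S}^{\mathcal{A}}$ is the space of real symmetric matrices indexed by $\mathcal{A}\times\mathcal{A}$, with inner product $\langle A,B\rangle=\sum_{\alpha,\beta}A_{\alpha\beta}B_{\alpha\beta}$. Let $u^{\mathcal{A}}(x)=(x^\alpha)_{\alpha\in\mathcal{A}}$ be the column vector of monomials, $\Gamma^{\mathcal{A}}=\{u^{\mathcal{A}}(x)u^{\mathcal{A}}(x)^T: x\in\mathbb{R}^{1+n}_+\}$, and $\mathbb{CPP}^{\mathcal{A}}=\mathrm{co}\,\Gamma^{\mathcal{A}}$ (convex hull). Choose $Q^i\in\mathbb{S}^{\mathcal{A}}$ with $\bar f_i(x)=\langle Q^i,u^{\mathcal{A}}(x)u^{\mathcal{A}}(x)^T\rangle$ for all $x\in\mathbb{R}^{1+n}$ ($i=0,\dots,m$). $H^0\in\mathbb{S}^{\mathcal{A}}$ is the matrix with entry $1$ at position $(\alpha^\omega,\alpha^\omega)$ and $0$ elsewhere. Define $\mathbb{J}=\{X\in\mathbb{CPP}^{\mathcal{A}}:\langle Q^i,X\rangle=0\ (i=1,\dots,m)\}$, and $\widetilde S_m=\{w\in\mathbb{R}^n_+:\bar f_i(0,w)=0\ (i=1,\dots,m)\}$. Infima are extended real numbers. A convex cone $\mathbb{J}\subset\mathbb{C}$ is a face of a convex cone $\mathbb{C}$ if $X^1,X^2\in\mathbb{J}$ whenever $X^1,X^2\in\mathbb{C}$ and $X^1/2+X^2/2\in\mathbb{J}$ (the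 face $\mathbb{J}=\mathbb{C}$ is allowed). *)

theory Defs
  imports "HOL-Analysis.Analysis" "HOL-Library.Poly_Mapping"
begin

text \<open>
  Real polynomials in the variables indexed by a finite type \<open>'v\<close> are elements of the monoid
  algebra over the exponent vectors. The variables \<open>w\<close> are indexed by \<open>'n\<close>, the variables
  \<open>x = (x\<^sub>0, w)\<close> by \<open>'n option\<close>, where \<open>None\<close> stands for the index \<open>0\<close>.
\<close>

type_synonym 'v exponent = "'v \<Rightarrow>\<^sub>0 nat"
type_synonym 'v mpoly = "'v exponent \<Rightarrow>\<^sub>0 real"

definition monom_degree :: "'v::finite exponent \<Rightarrow> nat" where
  "monom_degree \<alpha> = (\<Sum>j\<in>UNIV. Poly_Mapping.lookup \<alpha> j)"

text \<open>The zero polynomial gets degree 0.\<close>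

definition poly_degree :: "'v::finite mpoly \<Rightarrow> nat" where
  "poly_degree f = Max (insert 0 (monom_degree ` Poly_Mapping.keys f))"

definition monom_val :: "'v::finite exponent \<Rightarrow> real ^ 'v \<Rightarrow> real" where
  "monom_val \<alpha> x = (\<Prod>j\<in>UNIV. (x $ j) ^ Poly_Mapping.lookup \<alpha> j)"

definition poly_val :: "'v::finite mpoly \<Rightarrow> real ^ 'v \<Rightarrow> real" where
  "poly_val f x = (\<Sum>\<alpha>\<in>Poly_Mapping.keys f. Poly_Mapping.lookup f \<alpha> * monom_val \<alpha> x)"

definition nonneg_orthant :: "(real ^ 'v) set" where
  "nonneg_orthant = {x. \<forall>j. 0 \<le> x $ j}"

definition point :: "real \<Rightarrow> real ^ 'n \<Rightarrow> real ^ 'n option" where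
  "point x0 w = (\<chi> j. case j of None \<Rightarrow> x0 | Some i \<Rightarrow> w $ i)"

text \<open>
  The exponent of \<open>x\<^sub>0\<^bsup>d - |\<tau>|\<^esup> w\<^bsup>\<tau>\<^esup>\<close>; the subtraction is only meaningful for \<open>|\<tau>| \<le> d\<close>.
\<close>

definition homogenize_exponent :: "nat \<Rightarrow> 'n::finite exponent \<Rightarrow> 'n option exponent" where
  "homogenize_exponent d \<tau> =
     Poly_Mapping.single None (d - monom_degree \<tau>) +
     (\<Sum>i\<in>UNIV. Poly_Mapping.single (Some i) (Poly_Mapping.lookup \<tau> i))"

definition homogenize :: "nat \<Rightarrow> 'n::finite mpoly \<Rightarrow> 'n option mpoly" where
  "homogenize d f =
     (\<Sum>\<tau>\<in>Poly_Mapping.keys f. Poly_Mapping.single (homogenize_exponent d \<tau>) (Poly_Mapping.lookup f \<tau>))"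

lemma poly_val_eq_sum:
  assumes "finite S" "Poly_Mapping.keys f \<subseteq> S"
  shows "poly_val f x = (\<Sum>\<alpha>\<in>S. Poly_Mapping.lookup f \<alpha> * monom_val \<alpha> x)"
  unfolding poly_val_def
  by (rule sum.mono_neutral_left) (use assms in \<open>auto simp: in_keys_iff\<close>)

lemma poly_val_add: "poly_val (f + g) x = poly_val f x + poly_val g x"
proof -
  let ?S = "Poly_Mapping.keys f \<union> Poly_Mapping.keys g"
  have "poly_val (f + g) x = (\<Sum>\<alpha>\<in>?S. Poly_Mapping.lookup (f + g) \<alpha> * monom_val \<alpha> x)"
    by (rule poly_val_eq_sum) (simp_all add: Poly_Mapping.keys_add)
  moreover have "poly_val f x = (\<Sum>\<alpha>\<in>?S. Poly_Mapping.lookup f \<alpha> * monom_val \<alpha> x)"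
    by (rule poly_val_eq_sum) auto
  moreover have "poly_val g x = (\<Sum>\<alpha>\<in>?S. Poly_Mapping.lookup g \<alpha> * monom_val \<alpha> x)"
    by (rule poly_val_eq_sum) auto
  ultimately show ?thesis
    by (simp add: lookup_add distrib_right sum.distrib)
qed

lemma poly_val_single: "poly_val (Poly_Mapping.single \<alpha> c) x = c * monom_val \<alpha> x"
  by (subst poly_val_eq_sum[of "{\<alpha>}"]) auto

lemma poly_val_sum: "poly_val (\<Sum>i\<in>I. g i) x = (\<Sum>i\<in>I. poly_val (g i) x)"
  by (induction I rule: infinite_finite_induct) (auto simp: poly_val_add, auto simp: poly_val_def)

lemma lookup_homogenize_exponent:
  "Poly_Mapping.lookup (homogenize_exponent d \<tau>) None = d - monom_degree \<tau>"
  "Poly_Mapping.lookup (homogenize_exponent d \<tau>) (Some i) = Poly_Mapping.lookup \<tau> i"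
  by (auto simp: homogenize_exponent_def lookup_add lookup_sum lookup_single when_def)

lemma prod_option: "(\<Prod>j\<in>UNIV. h j) = h None * (\<Prod>i\<in>UNIV. h (Some i))"
  for h :: "'n::finite option \<Rightarrow> 'b::comm_monoid_mult"
  by (simp add: UNIV_option_conv prod.reindex)

lemma poly_val_homogenize:
  "poly_val (homogenize d f) (point x0 w) =
     (\<Sum>\<tau>\<in>Poly_Mapping.keys f.
        Poly_Mapping.lookup f \<tau> * x0 ^ (d - monom_degree \<tau>) * monom_val \<tau> w)"
  by (simp add: homogenize_def poly_val_sum poly_val_single monom_val_def prod_option
      lookup_homogenize_exponent point_def mult.assoc)

lemma poly_val_homogenize_one: "poly_val (homogenize d f) (point 1 w) = poly_val f w"
  by (simp add: poly_val_homogenize) (simp add: poly_val_def)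

definition exponents_of_degree :: "nat \<Rightarrow> 'v::finite exponent set" where
  "exponents_of_degree d = {\<alpha>. monom_degree \<alpha> = d}"

definition lead_exponent :: "nat \<Rightarrow> 'n option exponent" where
  "lead_exponent \<omega> = Poly_Mapping.single None \<omega>"

text \<open>
  The finite exponent set \<open>A\<close> is enumerated by a bijection \<open>e\<close> from a finite type \<open>'a\<close>, so that
  matrices indexed by \<open>A \<times> A\<close> are elements of \<^typ>\<open>real ^ 'a ^ 'a\<close>, whose inner product
  \<open>\<bullet>\<close> is the entrywise one.
\<close>

lemma inner_matrix_eq: "X \<bullet> Y = (\<Sum>a\<in>UNIV. \<Sum>b\<in>UNIV. X $ a $ b * Y $ a $ b)"
  for X Y :: "real ^ 'a ^ 'a"
  by (simp add: inner_vec_def)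

definition monom_vec :: "('a::finite \<Rightarrow> 'v::finite exponent) \<Rightarrow> real ^ 'v \<Rightarrow> real ^ 'a" where
  "monom_vec e x = (\<chi> a. monom_val (e a) x)"

definition outer :: "real ^ 'a \<Rightarrow> real ^ 'a \<Rightarrow> real ^ 'a ^ 'a" where
  "outer u v = (\<chi> a b. u $ a * v $ b)"

definition Gam :: "('a::finite \<Rightarrow> 'v::finite exponent) \<Rightarrow> (real ^ 'a ^ 'a) set" where
  "Gam e = {outer (monom_vec e x) (monom_vec e x) | x. x \<in> nonneg_orthant}"

definition CPP :: "('a::finite \<Rightarrow> 'v::finite exponent) \<Rightarrow> (real ^ 'a ^ 'a) set" where
  "CPP e = convex hull (Gam e)"

definition H0 :: "('a::finite \<Rightarrow> 'n option exponent) \<Rightarrow> nat \<Rightarrow> real ^ 'a ^ 'a" where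
  "H0 e \<omega> = (\<chi> a b. if e a = lead_exponent \<omega> \<and> e b = lead_exponent \<omega> then 1 else 0)"

definition JJ ::
  "('a::finite \<Rightarrow> 'v::finite exponent) \<Rightarrow> nat \<Rightarrow> (nat \<Rightarrow> real ^ 'a ^ 'a) \<Rightarrow> (real ^ 'a ^ 'a) set" where
  "JJ e m Q = {X \<in> CPP e. \<forall>i\<in>{1..m}. Q i \<bullet> X = 0}"

definition feasible_set :: "nat \<Rightarrow> (nat \<Rightarrow> 'n::finite mpoly) \<Rightarrow> (real ^ 'n) set" where
  "feasible_set m f = {w \<in> nonneg_orthant. \<forall>i\<in>{1..m}. poly_val (f i) w = 0}"

definition S_tilde :: "nat \<Rightarrow> nat \<Rightarrow> (nat \<Rightarrow> 'n::finite mpoly) \<Rightarrow> (real ^ 'n) set" where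
  "S_tilde \<omega> m f =
     {w \<in> nonneg_orthant. \<forall>i\<in>{1..m}. poly_val (homogenize (2 * \<omega>) (f i)) (point 0 w) = 0}"

definition opt_val :: "nat \<Rightarrow> (nat \<Rightarrow> 'n::finite mpoly) \<Rightarrow> ereal" where
  "opt_val m f = (INF w\<in>feasible_set m f. ereal (poly_val (f 0) w))"

text \<open>
  Faces are defined here through midpoints only and for cones, unlike \<^const>\<open>face_of\<close>, which
  quantifies over all points of open segments and applies to arbitrary convex sets.
\<close>

definition cone_face :: "'b::real_vector set \<Rightarrow> 'b set \<Rightarrow> bool" where
  "cone_face J C \<longleftrightarrow>
     convex_cone C \<and> convex_cone J \<and> J \<subseteq> C \<and>
     (\<forall>X1\<in>C. \<forall>X2\<in>C. (1/2) *\<^sub>R X1 + (1/2) *\<^sub>R X2 \<in> J \<longrightarrow> X1 \<in> J \<and> X2 \<in> J)"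

end

theory Submission
  imports Defs
begin

text \<open>
  If \<open>J\<close> is a face, every rank-one term in a decomposition of a member of \<open>J\<close> lies in \<open>J\<close> itself.
  A term generated by \<open>(x\<^sub>0, w)\<close> with \<open>x\<^sub>0 > 0\<close> is a positive multiple of the one generated by the
  feasible point \<open>(1, w / x\<^sub>0)\<close>, while a term with \<open>x\<^sub>0 = 0\<close> comes from a point of \<open>S_tilde\<close>
  and does not contribute to \<open>H0 \<bullet> X\<close>. So the conic problem has value \<open>\<zeta>\<^sup>*\<close> if the terms of the
  second kind have nonnegative objective value; otherwise adding multiples of such a term to a
  feasible matrix shows that it is unbounded below.
\<close>

text \<open>The sum is the midpoint of \<open>(2 * c v) *\<^sub>R v\<close> and twice the sum
  \<open>R\<close> of the other terms. Both lie in the cone \<open>C\<close>, so the face property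
  puts the first into \<open>J\<close>, and rescaling gives \<open>v\<close>.\<close>

lemma cone_face_summand:
  assumes face: "cone_face J C" and "finite S" "S \<subseteq> C"
    and nonneg: "\<And>v. v \<in> S \<Longrightarrow> 0 \<le> c v"
    and sum: "(\<Sum>v\<in>S. c v *\<^sub>R v) \<in> J"
    and v: "v \<in> S" "0 < c v"
  shows "v \<in> J"
proof -
  have C: "convex_cone C" and J: "convex_cone J"
    and split: "\<And>X Y. \<lbrakk>X \<in> C; Y \<in> C; (1/2) *\<^sub>R X + (1/2) *\<^sub>R Y \<in> J\<rbrakk> \<Longrightarrow> X \<in> J"
    using face unfolding cone_face_def by blast+
  define R where "R = (\<Sum>y\<in>S - {v}. c y *\<^sub>R y)"
  have "(\<Sum>y\<in>T. c y *\<^sub>R y) \<in> C" if "T \<subseteq> S" for T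
    using finite_subset[OF that \<open>finite S\<close>] that
  proof induction
    case empty
    show ?case using convex_cone_contains_0[OF C] by simp
  next
    case (insert y T)
    then show ?case
      using \<open>S \<subseteq> C\<close> nonneg by (auto intro!: convex_cone_add[OF C] convex_cone_scaleR[OF C])
  qed
  then have "2 *\<^sub>R R \<in> C"
    unfolding R_def by (intro convex_cone_scaleR[OF C]) auto
  moreover have "(2 * c v) *\<^sub>R v \<in> C"
    using v \<open>S \<subseteq> C\<close> by (intro convex_cone_scaleR[OF C]) auto
  moreover have "(1/2) *\<^sub>R ((2 * c v) *\<^sub>R v) + (1/2) *\<^sub>R (2 *\<^sub>R R) \<in> J"
    using sum by (simp add: R_def sum.remove[OF \<open>finite S\<close> v(1)])
  ultimately have "(2 * c v) *\<^sub>R v \<in> J"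
    using split by blast
  from convex_cone_scaleR[OF J _ this, of "1 / (2 * c v)"] show ?thesis
    using v by simp
qed

lemma monom_val_scaleR: "monom_val \<alpha> (c *\<^sub>R x) = c ^ monom_degree \<alpha> * monom_val \<alpha> x"
  by (simp add: monom_val_def monom_degree_def power_mult_distrib prod.distrib power_sum)

text \<open>Each entry is a product of two monomials of degree \<open>d\<close>. This is what allows
  passing between a point with positive \<open>None\<close> coordinate and its normalization to
  1.\<close>

lemma outer_monom_vec_scaleR:
  assumes "range e \<subseteq> exponents_of_degree d"
  shows "outer (monom_vec e (c *\<^sub>R x)) (monom_vec e (c *\<^sub>R x)) =
    c ^ (2 * d) *\<^sub>R outer (monom_vec e x) (monom_vec e x)"
proof -
  have "monom_degree (e a) = d" for a
    using assms by (auto simp: exponents_of_degree_def)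
  then show ?thesis
    by (simp add: outer_def monom_vec_def monom_val_scaleR vec_eq_iff power_mult power2_eq_square
        power_mult_distrib)
qed

lemma monom_val_lead_exponent: "monom_val (lead_exponent \<omega>) x = (x $ None) ^ \<omega>"
  by (simp add: monom_val_def lead_exponent_def prod_option lookup_single)

text \<open>Injectivity of \<open>e\<close> leaves exactly one index \<open>a\<close> carrying the
  lead exponent, so the inner product picks out a single diagonal entry, the square of
  \<open>(x $ None) ^ \<omega>\<close>.\<close>

lemma H0_inner_outer:
  assumes "inj e" "lead_exponent \<omega> \<in> range e"
  shows "H0 e \<omega> \<bullet> outer (monom_vec e x) (monom_vec e x) = (x $ None) ^ (2 * \<omega>)"
proof -
  obtain a where a: "e a = lead_exponent \<omega>"
    using assms(2) by auto
  have iff: "e b = lead_exponent \<omega> \<longleftrightarrow> b = a" for b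
    using assms(1) a by (metis injD)
  have "H0 e \<omega> \<bullet> outer (monom_vec e x) (monom_vec e x) =
      (\<Sum>b\<in>UNIV. \<Sum>c\<in>UNIV. if c = a then if b = a
        then monom_val (e b) x * monom_val (e c) x else 0 else 0)"
    unfolding inner_matrix_eq
    by (intro sum.cong refl) (auto simp: H0_def outer_def monom_vec_def iff)
  also have "\<dots> = (x $ None) ^ (2 * \<omega>)"
    by (simp add: a monom_val_lead_exponent mult_2 power_add)
  finally show ?thesis .
qed

lemma point_nonneg_iff: "point x0 w \<in> nonneg_orthant \<longleftrightarrow> 0 \<le> x0 \<and> w \<in> nonneg_orthant"
  unfolding nonneg_orthant_def point_def by (auto split: option.splits)

lemma point_nth_None: "point x0 w $ None = x0"
  by (simp add: point_def)

lemma point_components: "point (x $ None) (\<chi> i. x $ Some i) = x"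
  by (auto simp: point_def vec_eq_iff split: option.splits)

lemma scaleR_point: "c *\<^sub>R point x0 w = point (c * x0) (c *\<^sub>R w)"
  by (auto simp: point_def vec_eq_iff split: option.splits)

theorem theorem5p3:
  fixes \<omega> m :: nat
    and f :: "nat \<Rightarrow> 'n::finite mpoly"
    and A :: "'n option exponent set"
    and e :: "'a::finite \<Rightarrow> 'n option exponent"
    and Q :: "nat \<Rightarrow> real ^ 'a ^ 'a"
  assumes omega_pos: "0 < \<omega>"
    and deg: "\<forall>i\<le>m. poly_degree (f i) \<le> 2 * \<omega>"
    and A_sub: "A \<subseteq> exponents_of_degree \<omega>"
    and A_lead: "lead_exponent \<omega> \<in> A"
    and A_monoms: "\<forall>i\<le>m. \<forall>\<gamma>\<in>Poly_Mapping.keys (homogenize (2 * \<omega>) (f i)). \<exists>\<alpha>\<in>A. \<exists>\<beta>\<in>A. \<gamma> = \<alpha> + \<beta>"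
    and e_enum: "bij_betw e UNIV A"
    and Q_sym: "\<forall>i\<le>m. transpose (Q i) = Q i"
    and Q_repr: "\<forall>i\<le>m. \<forall>x. poly_val (homogenize (2 * \<omega>) (f i)) x
                    = Q i \<bullet> outer (monom_vec e x) (monom_vec e x)"
    and feasible: "feasible_set m f \<noteq> {}"
    and face: "cone_face (JJ e m Q) (CPP e)"
  shows "opt_val m f = (INF X\<in>{X \<in> JJ e m Q. H0 e \<omega> \<bullet> X = 1}. ereal (Q 0 \<bullet> X))
     \<longleftrightarrow> (INF w\<in>S_tilde \<omega> m f. ereal (poly_val (homogenize (2 * \<omega>) (f 0)) (point 0 w))) \<ge> 0
         \<or> opt_val m f = -\<infinity>"
proof -
  let ?F = "\<lambda>i. poly_val (homogenize (2 * \<omega>) (f i))"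
  let ?G = "\<lambda>x. outer (monom_vec e x) (monom_vec e x)"
  let ?J = "JJ e m Q"
  let ?opt = "INF X\<in>{X \<in> ?J. H0 e \<omega> \<bullet> X = 1}. ereal (Q 0 \<bullet> X)"
  have e: "inj e" "range e = A"
    using e_enum by (auto simp: bij_betw_def)
  have H0: "H0 e \<omega> \<bullet> ?G x = (x $ None) ^ (2 * \<omega>)" for x
    using e A_lead by (intro H0_inner_outer) auto
  have Q: "Q i \<bullet> ?G x = ?F i x" if "i \<le> m" for i x
    using Q_repr that by auto
  \<comment> \<open>Homogeneity is read off the matrix representation by \<open>Q\<close> and not
    off the polynomial itself.\<close>
  have hom: "?F i (c *\<^sub>R x) = c ^ (2 * \<omega>) * ?F i x" if "i \<le> m" for i c x
    using outer_monom_vec_scaleR[of e \<omega> c x] e A_sub by (simp flip: Q[OF that])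
  have J: "convex_cone ?J"
    using face by (simp add: cone_face_def)
  have G_CPP: "?G x \<in> CPP e" if "x \<in> nonneg_orthant" for x
    unfolding CPP_def by (rule hull_inc) (use that in \<open>auto simp: Gam_def\<close>)
  have G_J_iff: "?G x \<in> ?J \<longleftrightarrow> (\<forall>i\<in>{1..m}. ?F i x = 0)" if "x \<in> nonneg_orthant" for x
    using G_CPP[OF that] Q by (auto simp: JJ_def)
  have feasible_J: "?G (point 1 w) \<in> ?J" if "w \<in> feasible_set m f" for w
    using that
    by (subst G_J_iff) (auto simp: point_nonneg_iff feasible_set_def poly_val_homogenize_one)
  have S_tilde_J: "?G (point 0 w) \<in> ?J" if "w \<in> S_tilde \<omega> m f" for w
    using that by (subst G_J_iff) (auto simp: point_nonneg_iff S_tilde_def)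
  \<comment> \<open>Lifting \<open>w\<close> to \<open>?G (point 1 w)\<close> preserves feasibility
    and objective value, so the conic problem is a relaxation.\<close>
  have le: "?opt \<le> opt_val m f"
    unfolding opt_val_def
  proof (rule INF_greatest)
    fix w assume "w \<in> feasible_set m f"
    then show "?opt \<le> ereal (poly_val (f 0) w)"
      using feasible_J[of w] H0[of "point 1 w"] Q[of 0 "point 1 w"]
      by (intro INF_lower2[of "?G (point 1 w)"])
        (auto simp: point_nth_None poly_val_homogenize_one)
  qed
  \<comment> \<open>A homogeneous form of the lower bound \<open>z\<close>: the factor turns it into
    a bound by 0 at points with \<open>x $ None = 0\<close>, where only \<open>S\<close>
    applies.\<close>
  have bound_G: "z * (x $ None) ^ (2 * \<omega>) \<le> ?F 0 x"
    if z: "\<And>w. w \<in> feasible_set m f \<Longrightarrow> z \<le> poly_val (f 0) w"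
      and S: "\<And>w. w \<in> S_tilde \<omega> m f \<Longrightarrow> 0 \<le> ?F 0 (point 0 w)"
      and x: "x \<in> nonneg_orthant" "?G x \<in> ?J" for z x
  proof -
    define x0 w where "x0 = x $ None" and "w = (\<chi> i. x $ Some i)"
    have xeq: "x = point x0 w"
      by (simp add: x0_def w_def point_components)
    have nonneg: "0 \<le> x0" "w \<in> nonneg_orthant"
      using x(1) by (auto simp: xeq point_nonneg_iff)
    have zero: "?F i x = 0" if "i \<in> {1..m}" for i
      using x that G_J_iff by blast
    show ?thesis
    proof (cases "x0 = 0")
      case True
      then have "w \<in> S_tilde \<omega> m f"
        using zero nonneg by (auto simp: S_tilde_def xeq)
      \<comment> \<open>Positivity of \<open>\<omega>\<close> excludes the case
        \<open>0 ^ 0 = 1\<close>.\<close>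
      with S[of w] True omega_pos show ?thesis
        by (simp add: xeq point_nth_None power_0_left)
    next
      case False
      define v where "v = (1 / x0) *\<^sub>R w"
      have xv: "x = x0 *\<^sub>R point 1 v"
        using False by (simp add: xeq scaleR_point v_def)
      have F: "?F i x = x0 ^ (2 * \<omega>) * poly_val (f i) v" if "i \<le> m" for i
        unfolding xv hom[OF that] by (simp add: poly_val_homogenize_one)
      have "poly_val (f i) v = 0" if "i \<in> {1..m}" for i
        using zero[OF that] F[of i] that False by simp
      moreover have "v \<in> nonneg_orthant"
        using nonneg by (auto simp: v_def nonneg_orthant_def)
      ultimately have "z \<le> poly_val (f 0) v"
        by (intro z) (auto simp: feasible_set_def)
      then show ?thesis
        using F[of 0] nonneg by (simp add: x0_def[symmetric] mult.commute mult_right_mono)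
    qed
  qed
  have bound_J: "z * (H0 e \<omega> \<bullet> X) \<le> Q 0 \<bullet> X"
    if z: "\<And>w. w \<in> feasible_set m f \<Longrightarrow> z \<le> poly_val (f 0) w"
      and S: "\<And>w. w \<in> S_tilde \<omega> m f \<Longrightarrow> 0 \<le> ?F 0 (point 0 w)"
      and X: "X \<in> ?J" for z X
  proof -
    have "X \<in> convex hull (Gam e)"
      using X by (simp add: JJ_def CPP_def)
    then obtain V c where V: "finite V" "V \<subseteq> Gam e" "\<And>v. v \<in> V \<Longrightarrow> 0 \<le> c v"
      and X_eq: "X = (\<Sum>v\<in>V. c v *\<^sub>R v)"
      unfolding convex_hull_explicit by blast
    have "V \<subseteq> CPP e"
      using V(2) hull_subset[of "Gam e" convex] by (auto simp: CPP_def)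
    \<comment> \<open>The weight \<open>c v\<close> stays in the inequality because a term of weight
      0 may lie outside \<open>?J\<close>.\<close>
    have "z * (c v * (H0 e \<omega> \<bullet> v)) \<le> c v * (Q 0 \<bullet> v)" if v: "v \<in> V" for v
    proof (cases "c v = 0")
      case False
      then have "0 < c v"
        using V(3)[OF v] by simp
      then have vJ: "v \<in> ?J"
        using cone_face_summand[OF face V(1) \<open>V \<subseteq> CPP e\<close>, of c v] V(3) X v X_eq by blast
      obtain x where x: "x \<in> nonneg_orthant" "v = ?G x"
        using V(2) v by (auto simp: Gam_def)
      have "z * (H0 e \<omega> \<bullet> v) \<le> Q 0 \<bullet> v"
        using bound_G[OF z S, of x] x vJ H0[of x] Q[of 0 x] by simp
      then show ?thesis
        using \<open>0 < c v\<close> by (simp add: mult.left_commute)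
    qed simp
    then show ?thesis
      unfolding X_eq inner_sum_right inner_scaleR_right sum_distrib_left by (intro sum_mono)
  qed
  have INF_nonneg: "(INF w\<in>S_tilde \<omega> m f. ereal (?F 0 (point 0 w))) \<ge> 0 \<longleftrightarrow>
      (\<forall>w\<in>S_tilde \<omega> m f. 0 \<le> ?F 0 (point 0 w))"
    by (simp add: le_INF_iff)
  show ?thesis
    unfolding INF_nonneg
  proof
    assume eq: "opt_val m f = ?opt"
    show "(\<forall>w\<in>S_tilde \<omega> m f. 0 \<le> ?F 0 (point 0 w)) \<or> opt_val m f = -\<infinity>"
    proof (rule disjCI, rule ballI, rule ccontr)
      fix w assume finite: "opt_val m f \<noteq> -\<infinity>" and w: "w \<in> S_tilde \<omega> m f"
        and "\<not> 0 \<le> ?F 0 (point 0 w)"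
      define d where "d = ?F 0 (point 0 w)"
      have d: "d < 0"
        using \<open>\<not> 0 \<le> ?F 0 (point 0 w)\<close> by (simp add: d_def)
      obtain v where v: "v \<in> feasible_set m f"
        using feasible by blast
      \<comment> \<open>The matrix of \<open>point 0 w\<close> is a direction along which
        \<open>?J\<close> and the normalization by \<open>H0\<close> are preserved while the
        objective decreases at rate \<open>d\<close>.\<close>
      have "?opt \<le> ereal B" for B
      proof -
        define a where "a = poly_val (f 0) v"
        \<comment> \<open>As \<open>d\<close> is negative, \<open>a + t * d \<le> B\<close> means
          \<open>t \<ge> (B - a) / d\<close>; the maximum with 0 keeps the combination inside the
          cone.\<close>
        define t where "t = max 0 ((B - a) / d)"
        define X where "X = ?G (point 1 v) + t *\<^sub>R ?G (point 0 w)"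
        have "X \<in> ?J"
          unfolding X_def using feasible_J[OF v] S_tilde_J[OF w]
          by (intro convex_cone_add[OF J] convex_cone_scaleR[OF J]) (auto simp: t_def)
        moreover have "H0 e \<omega> \<bullet> X = 1"
          using omega_pos by (simp add: X_def inner_add_right H0 point_nth_None)
        moreover have "Q 0 \<bullet> X = a + t * d"
          by (simp add: X_def inner_add_right Q a_def d_def poly_val_homogenize_one)
        moreover have "a + t * d \<le> B"
        proof -
          have "(B - a) / d \<le> t"
            by (simp add: t_def)
          then show ?thesis
            using d by (simp add: neg_divide_le_eq)
        qed
        ultimately show ?thesis
          by (intro INF_lower2[of X]) auto
      qed
      then have "?opt = -\<infinity>"
        using ereal_bot by blast
      with eq finite show False
        by simp
    qed
  next
    assume "(\<forall>w\<in>S_tilde \<omega> m f. 0 \<le> ?F 0 (point 0 w)) \<or> opt_val m f = -\<infinity>"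
    then show "opt_val m f = ?opt"
    proof (elim disjE)
      assume S: "\<forall>w\<in>S_tilde \<omega> m f. 0 \<le> ?F 0 (point 0 w)"
      have "opt_val m f \<le> ?opt"
      \<comment> \<open>Only a finite value needs the bound: feasibility excludes plus infinity, and
        minus infinity is trivially below \<open>?opt\<close>.\<close>
      proof (cases "opt_val m f")
        case (real z)
        have "z \<le> poly_val (f 0) w" if "w \<in> feasible_set m f" for w
          using INF_lower[OF that, of "\<lambda>w. ereal (poly_val (f 0) w)"] real
          by (simp add: opt_val_def)
        then have "z * (H0 e \<omega> \<bullet> X) \<le> Q 0 \<bullet> X" if "X \<in> ?J" for X
          using bound_J S that by blast
        \<comment> \<open>On the slice \<open>H0 e \<omega> \<bullet> X = 1\<close> the homogeneous
          bound reads \<open>z \<le> Q 0 \<bullet> X\<close>.\<close>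
        then show ?thesis
          unfolding real by (intro INF_greatest) force
      next
        case PInf
        obtain w where "w \<in> feasible_set m f"
          using feasible by blast
        then have "opt_val m f \<le> ereal (poly_val (f 0) w)"
          unfolding opt_val_def by (rule INF_lower)
        with PInf show ?thesis
          by simp
      qed simp
      with le show ?thesis
        by simp
    next
      assume "opt_val m f = -\<infinity>"
      with le show ?thesis
        by simp
    qed
  qed
qed

end
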